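(* Let $\ell$ be a prime, $G$ a finite abelian group and $S\subseteq G$ a subset with $S$ generating $G$, $S=S^{-1}$ and $1\notin S$; put $r=\#S$ and assume $r\notin\{1,2\}$. Let $X=\mathrm{Cay}(G,S)$, let $\beta:S\to\mathbb{Z}_\ell$ satisfy conditions (1)–(4) below, and let $\alpha=\alpha_\beta$ be the associated voltage assignment. Then \[ f_{X,\alpha}(T)\sim \prod_{\psi\in\widehat{G}} P_\psi(T), \] i.e. $f_{X,\alpha}(T)$ equals $\prod_{\psi\in\widehat G}P_\psi(T)$ times a unit of $\mathcal{O}[\![T]\!]$.
   Context: $\mathrm{Cay}(G,S)$ is the graph with vertex set $\{v_g:g\in G\}$ having, for each ordered pair $(g_1,g_2)$ with $g_1g_2^{-1}\in S$, one directed edge $e(g_1,g_2)$ from $v_{g_1}$ to $v_{g_2}$ (its inverse edge being $e(g_2,g_1)$); it has no loops and every vertex has degree $r$. (The paper's standing assumption that $X$ is connected, has no vertex of degree $1$, and has nonzero Euler characteristic $\#V-\#E$, with $E$ the undirected edges, amounts to $r\notin\{1,2\}$.) The conditions on $\beta:S\to\mathbb{Z}_\ell$ are: (1) the image of $\beta$ generates $\mathbb{Z}_\ell$ as a $\mathbb{Z}_\ell$-module; (2) $\beta(s^{-1})=-\beta(s)$ for all $s\in S$; (3) $\beta(S)\subseteq\mathbb{Z}$; (4) there exist $m>0$ and $(h_1,\dots,h_m)\in S^m$ with $h_1\cdots h_m\in S$ and $\beta(h_1\cdots h_m)\not\equiv\sum_{i=1}^m\beta(h_i)\pmod{\ell}$.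 The voltage assignment is $\alpha(e(g_1,g_2)):=\beta(g_1g_2^{-1})$. Enumerate $G=\{g_1,\dots,g_n\}$ and let $\delta_S(g)=1$ if $g\in S$, $0$ otherwise. For $b\in\mathbb{Z}$, $(1+T)^b$ denotes the (unit) power series $\sum_{k\ge0}\binom{b}{k}T^k$. The Iwasawa polynomial is $f_{X,\alpha}(T)=\det\big(r\,\delta_{ij}-\delta_S(g_ig_j^{-1})(1+T)^{\beta(g_ig_j^{-1})}\big)_{i,j}\in\mathbb{Z}_\ell[\![T]\!]$. Let $\widehat G=\mathrm{Hom}(G,\mathbb{C}^\times)$; fix an embedding $\overline{\mathbb{Q}}\hookrightarrow\overline{\mathbb{Q}}_\ell$, let $K\subset\overline{\mathbb{Q}}_\ell$ be the field generated over $\mathbb{Q}_\ell$ by the $|G|$-th roots of unity and $\mathcal{O}$ its valuation ring, so every $\psi\in\widehat G$ takes values in $\mathcal{O}^\times$. With $m_\beta:=\max\{\beta(s):s\in S\}$, define $P_\psi(T):=r(1+T)^{m_\beta}-\sum_{s\in S}\psi(s)(1+T)^{m_\beta-\beta(s)}\in\mathcal{O}[T]$. *)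

theory Defs
  imports
    Complex_Main
    "HOL-Algebra.Algebraic_Closure_Type"
    "HOL-Algebra.Generated_Fields"
    "HOL-Algebra.Generated_Groups"
    "HOL-Computational_Algebra.Fraction_Field"
    "HOL-Computational_Algebra.Formal_Power_Series"
    "HOL-Computational_Algebra.Polynomial_FPS"
    "Berlekamp_Zassenhaus.Finite_Field"
    "Jordan_Normal_Form.Determinant"
    "Graph_Theory.Digraph"
    "HOL.Binomial_Plus"
begin

section \<open>The ring of \<open>\<ell>\<close>-adic integers\<close>

text \<open>The prime \<open>\<ell>\<close> is \<open>CARD('p)\<close> for a type variable \<open>'p\<close> of class \<open>prime_card\<close>.
  The ring \<open>\<int>\<^sub>\<ell>\<close> is the inverse limit of the rings \<open>\<int>/\<ell>\<^sup>n\<close>; residue classes are represented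
  by their representatives in \<open>{0..<\<ell>\<^sup>n}\<close> (the compatibility condition forces this range).\<close>

typedef 'p padic_int =
  "{x :: nat \<Rightarrow> int. \<forall>n. x (Suc n) mod int CARD('p) ^ n = x n}"
  by (rule exI[of _ "\<lambda>_. 0"]) simp

setup_lifting type_definition_padic_int

lemma mod_power_Suc: "(a mod (b::int) ^ Suc n) mod b ^ n = a mod b ^ n"
  by (rule mod_mod_cancel) (simp add: le_imp_power_dvd)

lemma compatible_mod: "\<forall>n. x (Suc n) mod (b::int) ^ n = x n \<Longrightarrow> x n mod b ^ n = x n"
  by (metis mod_mod_trivial)

instantiation padic_int :: (prime_card) comm_ring_1
begin

lift_definition zero_padic_int :: "'a padic_int" is "\<lambda>_. 0" by simp

lift_definition one_padic_int :: "'a padic_int" is "\<lambda>n. 1 mod int CARD('a) ^ n"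
  by (simp only: mod_power_Suc)

lift_definition plus_padic_int :: "'a padic_int \<Rightarrow> 'a padic_int \<Rightarrow> 'a padic_int"
  is "\<lambda>x y n. (x n + y n) mod int CARD('a) ^ n"
  by (simp only: mod_power_Suc) (metis mod_add_eq)

lift_definition uminus_padic_int :: "'a padic_int \<Rightarrow> 'a padic_int"
  is "\<lambda>x n. (- x n) mod int CARD('a) ^ n"
  by (simp only: mod_power_Suc) (metis mod_minus_eq)

lift_definition minus_padic_int :: "'a padic_int \<Rightarrow> 'a padic_int \<Rightarrow> 'a padic_int"
  is "\<lambda>x y n. (x n - y n) mod int CARD('a) ^ n"
  by (simp only: mod_power_Suc) (metis mod_diff_eq)

lift_definition times_padic_int :: "'a padic_int \<Rightarrow> 'a padic_int \<Rightarrow> 'a padic_int"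
  is "\<lambda>x y n. (x n * y n) mod int CARD('a) ^ n"
  by (simp only: mod_power_Suc) (metis mod_mult_eq)

instance
proof
  fix a b c :: "'a padic_int"
  show "a * b * c = a * (b * c)"
    by transfer (auto simp: fun_eq_iff mod_simps mult.assoc)
  show "a * b = b * a"
    by transfer (auto simp: fun_eq_iff mult.commute)
  show "1 * a = a"
    by transfer (auto simp: fun_eq_iff mod_simps compatible_mod)
  show "a + b + c = a + (b + c)"
    by transfer (auto simp: fun_eq_iff mod_simps add.assoc)
  show "a + b = b + a"
    by transfer (auto simp: fun_eq_iff add.commute)
  show "0 + a = a"
    by transfer (auto simp: fun_eq_iff compatible_mod)
  show "- a + a = 0"
    by transfer (auto simp: fun_eq_iff mod_simps)
  show "a - b = a + - b"
    by transfer (auto simp: fun_eq_iff mod_simps)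
  show "(a + b) * c = a * c + b * c"
    by transfer (auto simp: fun_eq_iff mod_simps distrib_right)
  have "(0::int) \<noteq> 1 mod int CARD('a) ^ 1"
    using prime_gt_1_nat[OF prime_card[where 'a='a]] by simp
  then show "(0::'a padic_int) \<noteq> 1"
    by transfer (metis)
qed

end

lemma Rep_padic_int_of_nat: "Rep_padic_int (of_nat k :: 'p::prime_card padic_int) n = int k mod int CARD('p) ^ n"
proof (induction k)
  case 0
  show ?case by (simp add: zero_padic_int.rep_eq)
next
  case (Suc k)
  then show ?case
    by (simp add: plus_padic_int.rep_eq one_padic_int.rep_eq mod_add_eq)
qed

lemma Rep_padic_int_mod:
  "Rep_padic_int (x :: 'p padic_int) (n + k) mod int CARD('p) ^ n = Rep_padic_int x n"
proof (induction k)
  case 0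
  show ?case using Rep_padic_int[of x] by (simp, metis mod_mod_trivial)
next
  case (Suc k)
  have "Rep_padic_int x (n + k) = Rep_padic_int x (Suc (n + k)) mod int CARD('p) ^ (n + k)"
    using Rep_padic_int[of x] by simp
  then have "Rep_padic_int x (n + k) mod int CARD('p) ^ n = Rep_padic_int x (Suc (n + k)) mod int CARD('p) ^ n"
    by (simp add: mod_mod_cancel le_imp_power_dvd)
  with Suc show ?case by simp
qed

lemma prime_power_dvd_padic_int_iff:
  fixes x :: "'p::prime_card padic_int"
  shows "of_nat CARD('p) ^ n dvd x \<longleftrightarrow> Rep_padic_int x n = 0"
proof
  assume "of_nat CARD('p) ^ n dvd x"
  then obtain y where y: "x = of_nat (CARD('p) ^ n) * y" by auto
  show "Rep_padic_int x n = 0"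
    unfolding y times_padic_int.rep_eq Rep_padic_int_of_nat by simp
next
  assume *: "Rep_padic_int x n = 0"
  let ?q = "int CARD('p)"
  have q: "?q > 0" using prime_gt_0_nat[OF prime_card[where 'a='p]] by simp
  define y where "y = (\<lambda>k. Rep_padic_int x (n + k) div ?q ^ n)"
  have dvd: "?q ^ n dvd Rep_padic_int x (n + k)" for k
    using Rep_padic_int_mod[of x n k] * by auto
  have y_eq: "y (Suc k) mod ?q ^ k = y k" for k
  proof -
    have "Rep_padic_int x (n + k) = Rep_padic_int x (n + Suc k) mod (?q ^ n * ?q ^ k)"
      using Rep_padic_int[of x] by (simp flip: power_add)
    also have "\<dots> = ?q ^ n * (y (Suc k) mod ?q ^ k)"
      using dvd[of "Suc k"] by (simp add: y_def mult_mod_right)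
    finally show ?thesis using q by (simp add: y_def)
  qed
  have Ry: "Rep_padic_int (Abs_padic_int y :: 'p padic_int) = y"
    using y_eq by (intro Abs_padic_int_inverse) simp
  have "x = of_nat (CARD('p) ^ n) * Abs_padic_int y"
  proof (rule iffD1[OF Rep_padic_int_inject], rule ext)
    fix k
    have "Rep_padic_int (of_nat (CARD('p) ^ n) * Abs_padic_int y :: 'p padic_int) k
        = (?q ^ n * y k) mod ?q ^ k"
      by (simp only: times_padic_int.rep_eq Rep_padic_int_of_nat Ry) (simp add: mod_simps)
    also have "?q ^ n * y k = Rep_padic_int x (k + n)"
      using dvd[of k] by (simp add: y_def add.commute)
    also have "\<dots> mod ?q ^ k = Rep_padic_int x k" by (rule Rep_padic_int_mod)
    finally show "Rep_padic_int x k =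
      Rep_padic_int (of_nat (CARD('p) ^ n) * Abs_padic_int y :: 'p padic_int) k" ..
  qed
  then show "of_nat CARD('p) ^ n dvd x" by (metis dvd_triv_left of_nat_power)
qed

definition padic_val :: "'p::prime_card padic_int \<Rightarrow> nat" where
  "padic_val x = Max {n. of_nat CARD('p) ^ n dvd x}"

lemma finite_padic_val_set:
  fixes x :: "'p::prime_card padic_int"
  assumes "x \<noteq> 0"
  shows "finite {n. of_nat CARD('p) ^ n dvd x}"
proof -
  from assms obtain m where m: "Rep_padic_int x m \<noteq> 0"
    by (metis (no_types) Rep_padic_int_inject zero_padic_int.rep_eq ext)
  have "n < m" if "of_nat CARD('p) ^ n dvd x" for n
  proof (rule ccontr)
    assume "\<not> n < m"
    then have "of_nat CARD('p) ^ m dvd x" using that by (meson dvd_trans le_imp_power_dvd not_less)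
    with m show False by (simp add: prime_power_dvd_padic_int_iff)
  qed
  then show ?thesis by (metis (no_types, lifting) finite_nat_set_iff_bounded mem_Collect_eq)
qed

lemma padic_val_dvd_iff:
  fixes x :: "'p::prime_card padic_int"
  assumes "x \<noteq> 0"
  shows "of_nat CARD('p) ^ n dvd x \<longleftrightarrow> n \<le> padic_val x"
proof
  assume "of_nat CARD('p) ^ n dvd x"
  then show "n \<le> padic_val x"
    unfolding padic_val_def using finite_padic_val_set[OF assms] by (intro Max_ge) auto
next
  assume n: "n \<le> padic_val x"
  have "padic_val x \<in> {n. of_nat CARD('p) ^ n dvd x}"
    unfolding padic_val_def by (rule Max_in[OF finite_padic_val_set[OF assms]]) (auto intro: exI[of _ 0])
  with n show "of_nat CARD('p) ^ n dvd x" by (meson dvd_trans le_imp_power_dvd mem_Collect_eq)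
qed

lemma padic_int_decomp:
  fixes x :: "'p::prime_card padic_int"
  assumes "x \<noteq> 0"
  obtains u where "x = of_nat CARD('p) ^ padic_val x * u" "\<not> of_nat CARD('p) dvd u"
proof -
  obtain u where u: "x = of_nat CARD('p) ^ padic_val x * u"
    using padic_val_dvd_iff[OF assms, of "padic_val x"] by (auto elim: dvdE)
  have "\<not> of_nat CARD('p) dvd u"
  proof
    assume "of_nat CARD('p) dvd u"
    then have "of_nat CARD('p) ^ Suc (padic_val x) dvd x"
      by (subst u) (simp add: mult.commute mult_dvd_mono)
    then show False using padic_val_dvd_iff[OF assms, of "Suc (padic_val x)"] by simp
  qed
  with u that show thesis by blast
qed

lemma prime_dvd_mult_padic_int:
  fixes x y :: "'p::prime_card padic_int"
  assumes "of_nat CARD('p) dvd x * y"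
  shows "of_nat CARD('p) dvd x \<or> of_nat CARD('p) dvd y"
proof -
  have p: "Factorial_Ring.prime (int CARD('p))" using prime_card_int[where 'a='p] .
  have r: "Rep_padic_int z 1 mod int CARD('p) = Rep_padic_int z 1" for z :: "'p padic_int"
    using Rep_padic_int_mod[of z 1 0] by simp
  have "Rep_padic_int (x * y) 1 = 0"
    using assms prime_power_dvd_padic_int_iff[of 1 "x * y"] by simp
  then have "int CARD('p) dvd Rep_padic_int x 1 * Rep_padic_int y 1"
    by (simp add: times_padic_int.rep_eq dvd_eq_mod_eq_0)
  then have "int CARD('p) dvd Rep_padic_int x 1 \<or> int CARD('p) dvd Rep_padic_int y 1"
    using p by (simp add: prime_dvd_mult_iff)
  then have "Rep_padic_int x 1 = 0 \<or> Rep_padic_int y 1 = 0"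
    using r by (metis dvd_imp_mod_0)
  then show ?thesis
    using prime_power_dvd_padic_int_iff[of 1 x] prime_power_dvd_padic_int_iff[of 1 y] by simp
qed

lemma prime_power_cancel_padic_int:
  fixes x :: "'p::prime_card padic_int"
  shows "of_nat CARD('p) ^ (k + n) dvd of_nat CARD('p) ^ k * x \<longleftrightarrow> of_nat CARD('p) ^ n dvd x"
proof
  let ?q = "int CARD('p)"
  have q: "?q > 0" using prime_gt_0_nat[OF prime_card[where 'a='p]] by simp
  assume "of_nat CARD('p) ^ (k + n) dvd of_nat CARD('p) ^ k * x"
  then have "of_nat CARD('p) ^ (k + n) dvd of_nat (CARD('p) ^ k) * x" by simp
  then have "Rep_padic_int (of_nat (CARD('p) ^ k) * x) (n + k) = 0"
    by (simp only: prime_power_dvd_padic_int_iff add.commute)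
  then have "(?q ^ k * Rep_padic_int x (n + k)) mod (?q ^ (n + k)) = 0"
    by (simp only: times_padic_int.rep_eq Rep_padic_int_of_nat) (simp add: mod_simps)
  then have "?q ^ k * ?q ^ n dvd ?q ^ k * Rep_padic_int x (n + k)"
    by (simp add: dvd_eq_mod_eq_0 power_add mult.commute)
  then have "?q ^ n dvd Rep_padic_int x (n + k)" using q by simp
  then show "of_nat CARD('p) ^ n dvd x"
    using Rep_padic_int_mod[of x n k] by (simp add: prime_power_dvd_padic_int_iff)
next
  assume "of_nat CARD('p) ^ n dvd x"
  then show "of_nat CARD('p) ^ (k + n) dvd of_nat CARD('p) ^ k * x"
    by (simp add: power_add mult_dvd_mono)
qed

lemma padic_val_mult_aux:
  fixes x y :: "'p::prime_card padic_int"
  assumes "x \<noteq> 0" "y \<noteq> 0"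
  shows "of_nat CARD('p) ^ n dvd x * y \<longleftrightarrow> n \<le> padic_val x + padic_val y"
proof -
  obtain u where u: "x = of_nat CARD('p) ^ padic_val x * u" "\<not> of_nat CARD('p) dvd u"
    using padic_int_decomp[OF assms(1)] .
  obtain v where v: "y = of_nat CARD('p) ^ padic_val y * v" "\<not> of_nat CARD('p) dvd v"
    using padic_int_decomp[OF assms(2)] .
  let ?k = "padic_val x + padic_val y"
  have "x * y = (of_nat CARD('p) ^ padic_val x * u) * (of_nat CARD('p) ^ padic_val y * v)"
    by (rule arg_cong2[where f = "(*)", OF u(1) v(1)])
  then have xy: "x * y = of_nat CARD('p) ^ ?k * (u * v)"
    by (simp only: power_add ac_simps)
  have no: "\<not> of_nat CARD('p) ^ (?k + 1) dvd x * y"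
    unfolding xy prime_power_cancel_padic_int using prime_dvd_mult_padic_int u(2) v(2) by auto
  have yes: "of_nat CARD('p) ^ ?k dvd x * y" unfolding xy by (rule dvd_triv_left)
  show ?thesis
  proof
    assume "of_nat CARD('p) ^ n dvd x * y"
    then show "n \<le> ?k"
      using no by (metis Suc_eq_plus1 dvd_trans le_imp_power_dvd not_less_eq_eq)
  next
    assume "n \<le> ?k"
    then show "of_nat CARD('p) ^ n dvd x * y"
      using yes by (meson dvd_trans le_imp_power_dvd)
  qed
qed

instance padic_int :: (prime_card) idom
proof
  fix x y :: "'a padic_int"
  assume "x \<noteq> 0" "y \<noteq> 0"
  then have "\<not> of_nat CARD('a) ^ (Suc (padic_val x + padic_val y)) dvd x * y"
    using padic_val_mult_aux[of x y "Suc (padic_val x + padic_val y)"] by simp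
  then show "x * y \<noteq> 0" by auto
qed

instance padic_int :: (prime_card) ring_char_0
proof
  show "inj (of_nat :: nat \<Rightarrow> 'a padic_int)"
  proof (rule injI)
    fix m n :: nat
    assume eq: "(of_nat m :: 'a padic_int) = of_nat n"
    have less: "k < CARD('a) ^ (m + n)" if "k \<le> m + n" for k
      using that power_gt_expt[of "CARD('a)" "m + n"] prime_gt_1_nat[OF prime_card[where 'a='a]]
      by simp
    from eq have "int m mod int CARD('a) ^ (m + n) = int n mod int CARD('a) ^ (m + n)"
      by (simp flip: Rep_padic_int_of_nat)
    then have "int (m mod CARD('a) ^ (m + n)) = int (n mod CARD('a) ^ (m + n))"
      by (simp only: zmod_int of_nat_power)
    with less[of m] less[of n] show "m = n" by simp
  qed
qed

lemma padic_val_mult: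
  fixes x y :: "'p::prime_card padic_int"
  assumes "x \<noteq> 0" "y \<noteq> 0"
  shows "padic_val (x * y) = padic_val x + padic_val y"
proof -
  have "n \<le> padic_val (x * y) \<longleftrightarrow> n \<le> padic_val x + padic_val y" for n
    using padic_val_mult_aux[OF assms, of n] padic_val_dvd_iff[of "x * y" n] assms by simp
  then show ?thesis by (metis order_antisym order_refl)
qed


section \<open>The field \<open>\<rat>\<^sub>\<ell>\<close> and its algebraic closure\<close>

instance fract :: ("{idom, ring_char_0}") field_char_0
proof
  show "inj (of_nat :: nat \<Rightarrow> 'a fract)"
    by (rule injI) (simp add: of_nat_fract eq_fract)
qed

type_synonym 'p padic = "'p padic_int fract"
type_synonym 'p padic_bar = "'p padic_int fract alg_closure"

definition padic_int_to_bar :: "'p::prime_card padic_int \<Rightarrow> 'p padic_bar" where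
  "padic_int_to_bar x = to_ac (Fract x 1)"

definition padic_int_abs :: "'p::prime_card padic_int \<Rightarrow> real" where
  "padic_int_abs x = (if x = 0 then 0 else 1 / real CARD('p) ^ padic_val x)"

lemma padic_int_abs_mult: "padic_int_abs (x * y) = padic_int_abs x * padic_int_abs y"
  by (simp add: padic_int_abs_def padic_val_mult power_add)

lemma padic_int_abs_eq_0_iff: "padic_int_abs (x :: 'p::prime_card padic_int) = 0 \<longleftrightarrow> x = 0"
  using prime_gt_0_nat[OF prime_card[where 'a='p]] by (simp add: padic_int_abs_def)

definition padic_abs :: "'p::prime_card padic \<Rightarrow> real" where
  "padic_abs q = (THE r. \<exists>a b. b \<noteq> 0 \<and> q = Fract a b \<and> r = padic_int_abs a / padic_int_abs b)"

lemma padic_abs_Fract: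
  assumes "b \<noteq> 0"
  shows "padic_abs (Fract a b) = padic_int_abs a / padic_int_abs b"
  unfolding padic_abs_def
proof (rule the_equality)
  fix r
  assume "\<exists>c d. d \<noteq> 0 \<and> Fract a b = Fract c d \<and> r = padic_int_abs c / padic_int_abs d"
  then obtain c d where cd: "d \<noteq> 0" "Fract a b = Fract c d" "r = padic_int_abs c / padic_int_abs d"
    by blast
  then have "a * d = c * b" using assms by (simp add: eq_fract)
  then have "padic_int_abs a * padic_int_abs d = padic_int_abs c * padic_int_abs b"
    by (simp flip: padic_int_abs_mult)
  then show "r = padic_int_abs a / padic_int_abs b"
    using cd assms by (simp add: frac_eq_eq padic_int_abs_eq_0_iff)
qed (use assms in blast)

definition padic_minpoly :: "'p::prime_card padic_bar \<Rightarrow> 'p padic poly" where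
  "padic_minpoly x = (THE p. Polynomial.lead_coeff p = 1 \<and> Factorial_Ring.irreducible p \<and>
     poly (map_poly to_ac p) x = 0)"

text \<open>The unique extension of the \<open>\<ell>\<close>-adic absolute value to the algebraic closure: the absolute
  value of the norm of \<open>x\<close> from \<open>\<rat>\<^sub>\<ell>(x)\<close> to \<open>\<rat>\<^sub>\<ell>\<close> is that of the constant coefficient of the
  minimal polynomial, and one takes its \<open>d\<close>-th root, \<open>d\<close> being the degree of \<open>x\<close>.\<close>

definition padic_bar_abs :: "'p::prime_card padic_bar \<Rightarrow> real" where
  "padic_bar_abs x = root (Polynomial.degree (padic_minpoly x))
     (padic_abs (Polynomial.coeff (padic_minpoly x) 0))"

lemma poly_map_poly_to_ac: "poly (map_poly to_ac p) (to_ac q) = to_ac (poly p q)"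
  by (induction p) (simp_all add: map_poly_pCons)

lemma padic_minpoly_to_ac: "padic_minpoly (to_ac q) = [:-q, 1:]"
  unfolding padic_minpoly_def
proof (rule the_equality, intro conjI)
  show "Polynomial.lead_coeff [:-q, 1:] = 1" by simp
  show "Factorial_Ring.irreducible [:-q, 1:]"
    by (rule irreducible_linear_field_poly) simp
  show "poly (map_poly to_ac [:-q, 1:]) (to_ac q) = 0"
    by (simp only: poly_map_poly_to_ac) simp
next
  fix p :: "'a padic poly"
  assume p: "Polynomial.lead_coeff p = 1 \<and> Factorial_Ring.irreducible p \<and>
    poly (map_poly to_ac p) (to_ac q) = 0"
  then have "poly p q = 0" by (simp add: poly_map_poly_to_ac)
  then obtain c where c: "p = [:-q, 1:] * c" by (auto simp: poly_eq_0_iff_dvd elim: dvdE)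
  have "\<not> is_unit [:-q, 1:]" by (simp add: is_unit_iff_degree)
  with p c have "is_unit c" by (metis Factorial_Ring.irreducibleD)
  then obtain d where "c = [:d:]" by (metis degree_eq_zeroE is_unit_iff_degree not_is_unit_0)
  moreover have "d = 1"
    using p unfolding c \<open>c = [:d:]\<close> by (simp only: lead_coeff_mult) simp
  ultimately show "p = [:-q, 1:]" using c by simp
qed

lemma padic_bar_abs_to_ac: "padic_bar_abs (to_ac q) = padic_abs q"
proof (cases q)
  case (Fract a b)
  have "padic_val (- a) = padic_val a" by (simp add: padic_val_def)
  then have "padic_int_abs (- a) = padic_int_abs a" by (simp add: padic_int_abs_def)
  then show ?thesis
    using Fract by (simp add: padic_bar_abs_def padic_minpoly_to_ac padic_abs_Fract)
qed

definition cyclotomic_padic_field :: "nat \<Rightarrow> 'p::prime_card padic_bar set" where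
  "cyclotomic_padic_field n =
     generate_field ring_of_type_algebra (range to_ac \<union> {z. z ^ n = 1})"

definition padic_valuation_ring :: "'p::prime_card padic_bar set \<Rightarrow> 'p padic_bar set" where
  "padic_valuation_ring K = {x \<in> K. padic_bar_abs x \<le> 1}"

definition algebraic_embedding :: "(complex \<Rightarrow> 'a::field) \<Rightarrow> bool" where
  "algebraic_embedding \<iota> \<longleftrightarrow> \<iota> 1 = 1 \<and>
     (\<forall>x y. Polynomial.algebraic x \<longrightarrow> Polynomial.algebraic y \<longrightarrow>
        \<iota> (x + y) = \<iota> x + \<iota> y \<and> \<iota> (x * y) = \<iota> x * \<iota> y)"

definition fps_over :: "'a::comm_ring_1 set \<Rightarrow> 'a fps set" where
  "fps_over R = {f. \<forall>n. fps_nth f n \<in> R}"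

definition fps_units_over :: "'a::comm_ring_1 set \<Rightarrow> 'a fps set" where
  "fps_units_over R = {u \<in> fps_over R. \<exists>v \<in> fps_over R. u * v = 1}"

definition fps_to_bar :: "'p::prime_card padic_int fps \<Rightarrow> 'p padic_bar fps" where
  "fps_to_bar f = Abs_fps (\<lambda>n. padic_int_to_bar (fps_nth f n))"


section \<open>Cayley graphs, voltages and the Iwasawa polynomial\<close>

definition cayley_graph :: "('g, 'm) monoid_scheme \<Rightarrow> 'g set \<Rightarrow> ('g, 'g \<times> 'g) pre_digraph" where
  "cayley_graph G S =
     \<lparr> verts = carrier G,
       arcs = {(g, h). g \<in> carrier G \<and> h \<in> carrier G \<and> g \<otimes>\<^bsub>G\<^esub> inv\<^bsub>G\<^esub> h \<in> S},
       tail = fst, head = snd \<rparr>"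

definition cayley_voltage :: "('g, 'm) monoid_scheme \<Rightarrow> ('g \<Rightarrow> 'a) \<Rightarrow> 'g \<times> 'g \<Rightarrow> 'a" where
  "cayley_voltage G \<beta> = (\<lambda>(g, h). \<beta> (g \<otimes>\<^bsub>G\<^esub> inv\<^bsub>G\<^esub> h))"

definition int_binomial_coeff :: "int \<Rightarrow> nat \<Rightarrow> int" where
  "int_binomial_coeff b k = (\<Prod>i=0..<k. b - int i) div fact k"

lemma of_int_int_binomial_coeff:
  "(of_int (int_binomial_coeff b k) :: 'a::field_char_0) = of_int b gchoose k"
proof -
  have "fact k dvd (\<Prod>i=0..<k. b - int i)"
    unfolding gbinomial_int_mult_fact[symmetric] by (rule dvd_triv_left)
  then obtain c where c: "(\<Prod>i=0..<k. b - int i) = fact k * c" by (elim dvdE)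
  have "(of_int b gchoose k :: 'a) = of_int (\<Prod>i=0..<k. b - int i) / fact k"
    unfolding gbinomial_prod_rev of_int_prod by simp
  also have "\<dots> = of_int c" unfolding c by simp
  also have "c = int_binomial_coeff b k" unfolding int_binomial_coeff_def c by simp
  finally show ?thesis ..
qed

definition one_plus_T_powi :: "int \<Rightarrow> 'a::comm_ring_1 fps" where
  "one_plus_T_powi b = Abs_fps (\<lambda>k. of_int (int_binomial_coeff b k))"

text \<open>Only used for elements of the subring \<open>\<int>\<close> of \<open>\<int>\<^sub>\<ell>\<close>.\<close>

definition padic_to_int :: "'p::prime_card padic_int \<Rightarrow> int" where
  "padic_to_int x = (THE b. x = of_int b)"

lemma padic_to_int_of_int [simp]: "padic_to_int (of_int b) = b"
  by (simp add: padic_to_int_def)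

text \<open>For an integer-valued voltage \<open>\<alpha>\<close> on the directed edges of a graph and an enumeration \<open>v\<close> of its
  vertices this is the determinant of the degree matrix minus the adjacency matrix in which an
  edge \<open>e\<close> is counted with weight \<open>(1 + T)\<^bsup>\<alpha>(e)\<^esup>\<close>.\<close>

definition iwasawa_poly ::
  "('v, 'e) pre_digraph \<Rightarrow> ('e \<Rightarrow> 'p::prime_card padic_int) \<Rightarrow> (nat \<Rightarrow> 'v) \<Rightarrow> 'p padic_int fps" where
  "iwasawa_poly \<Gamma> \<alpha> v = Determinant.det (mat (card (verts \<Gamma>)) (card (verts \<Gamma>)) (\<lambda>(i, j).
     (if i = j then of_nat (out_degree \<Gamma> (v i)) else 0) -
     (\<Sum>e | e \<in> arcs \<Gamma> \<and> tail \<Gamma> e = v i \<and> head \<Gamma> e = v j. one_plus_T_powi (padic_to_int (\<alpha> e)))))"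

lemma out_degree_cayley_graph:
  assumes "comm_group G" "S \<subseteq> carrier G" "m_inv G ` S = S" "g \<in> carrier G"
  shows "out_degree (cayley_graph G S) g = card S"
proof -
  interpret comm_group G by fact
  have "bij_betw (\<lambda>s. (g, inv\<^bsub>G\<^esub> s \<otimes>\<^bsub>G\<^esub> g)) S (out_arcs (cayley_graph G S) g)"
  proof (rule bij_betwI[where g = "\<lambda>(a, h). a \<otimes>\<^bsub>G\<^esub> inv\<^bsub>G\<^esub> h"])
    show "(\<lambda>s. (g, inv\<^bsub>G\<^esub> s \<otimes>\<^bsub>G\<^esub> g)) \<in> S \<rightarrow> out_arcs (cayley_graph G S) g"
    proof
      fix s assume s: "s \<in> S"
      then have "s \<in> carrier G" using assms(2) by auto
      then have "g \<otimes>\<^bsub>G\<^esub> inv\<^bsub>G\<^esub> (inv\<^bsub>G\<^esub> s \<otimes>\<^bsub>G\<^esub> g) = s"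
        using assms(4) by (simp add: inv_mult m_lcomm[of g s])
      with s \<open>s \<in> carrier G\<close> show "(g, inv\<^bsub>G\<^esub> s \<otimes>\<^bsub>G\<^esub> g) \<in> out_arcs (cayley_graph G S) g"
        using assms(4) by (simp add: out_arcs_def cayley_graph_def)
    qed
    show "(\<lambda>(a, h). a \<otimes>\<^bsub>G\<^esub> inv\<^bsub>G\<^esub> h) \<in> out_arcs (cayley_graph G S) g \<rightarrow> S"
      by (auto simp: out_arcs_def cayley_graph_def)
  next
    fix s assume "s \<in> S"
    then have "s \<in> carrier G" using assms(2) by auto
    then show "(case (g, inv\<^bsub>G\<^esub> s \<otimes>\<^bsub>G\<^esub> g) of (a, h) \<Rightarrow> a \<otimes>\<^bsub>G\<^esub> inv\<^bsub>G\<^esub> h) = s"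
      using assms(4) by (simp add: inv_mult m_lcomm[of g s])
  next
    fix e assume "e \<in> out_arcs (cayley_graph G S) g"
    then obtain h where h: "e = (g, h)" "h \<in> carrier G"
      by (auto simp: out_arcs_def cayley_graph_def)
    then have "inv\<^bsub>G\<^esub> (g \<otimes>\<^bsub>G\<^esub> inv\<^bsub>G\<^esub> h) \<otimes>\<^bsub>G\<^esub> g = h"
      using assms(4) by (simp add: inv_mult m_comm[of "inv\<^bsub>G\<^esub> g" h] m_assoc)
    with h show "(g, inv\<^bsub>G\<^esub> (case e of (a, h) \<Rightarrow> a \<otimes>\<^bsub>G\<^esub> inv\<^bsub>G\<^esub> h) \<otimes>\<^bsub>G\<^esub> g) = e" by simp
  qed
  then show ?thesis unfolding out_degree_def by (rule bij_betw_same_card[symmetric])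
qed

lemma iwasawa_poly_cayley:
  assumes "comm_group G" "S \<subseteq> carrier G" "m_inv G ` S = S"
    and "bij_betw g {..<card (carrier G)} (carrier G)"
  shows "iwasawa_poly (cayley_graph G S) (cayley_voltage G \<beta>) g =
    Determinant.det (mat (card (carrier G)) (card (carrier G)) (\<lambda>(i, j).
      of_nat (card S) * (if i = j then 1 else 0) -
      (if g i \<otimes>\<^bsub>G\<^esub> inv\<^bsub>G\<^esub> g j \<in> S then 1 else 0) *
        one_plus_T_powi (padic_to_int (\<beta> (g i \<otimes>\<^bsub>G\<^esub> inv\<^bsub>G\<^esub> g j)))))"
proof -
  have arcs: "{e. e \<in> arcs (cayley_graph G S) \<and> tail (cayley_graph G S) e = g i \<and>
      head (cayley_graph G S) e = g j} = (if g i \<otimes>\<^bsub>G\<^esub> inv\<^bsub>G\<^esub> g j \<in> S then {(g i, g j)} else {})"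
    if "i < card (carrier G)" "j < card (carrier G)" for i j
  proof -
    have "g i \<in> carrier G" "g j \<in> carrier G" using that assms(4) by (auto dest: bij_betwE)
    then show ?thesis by (auto simp: cayley_graph_def)
  qed
  have deg: "out_degree (cayley_graph G S) (g i) = card S" if "i < card (carrier G)" for i
    using that assms(4) by (intro out_degree_cayley_graph[OF assms(1-3)]) (auto dest: bij_betwE)
  have card: "card (verts (cayley_graph G S)) = card (carrier G)"
    by (simp add: cayley_graph_def)
  show ?thesis
    unfolding iwasawa_poly_def card
    by (intro arg_cong[where f = Determinant.det] cong_mat refl)
      (simp add: arcs deg cayley_voltage_def)
qed


section \<open>Characters\<close>

definition complex_units :: "complex monoid" where
  "complex_units = \<lparr> carrier = - {0}, monoid.mult = (*), one = 1 \<rparr>"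

text \<open>Extensionality makes equality of characters mean equality on \<open>carrier G\<close>.\<close>

definition characters :: "('g, 'm) monoid_scheme \<Rightarrow> ('g \<Rightarrow> complex) set" where
  "characters G = hom G complex_units \<inter> extensional (carrier G)"

definition beta_max :: "'g set \<Rightarrow> ('g \<Rightarrow> 'p::prime_card padic_int) \<Rightarrow> int" where
  "beta_max S \<beta> = Max ((\<lambda>s. padic_to_int (\<beta> s)) ` S)"

text \<open>The exponents are nonnegative: \<open>beta_max S \<beta> \<ge> 0\<close> because \<open>\<beta>(s\<^sup>-\<^sup>1) = -\<beta>(s)\<close>.\<close>

definition character_poly ::
  "(complex \<Rightarrow> 'p padic_bar) \<Rightarrow> 'g set \<Rightarrow> ('g \<Rightarrow> 'p::prime_card padic_int) \<Rightarrow> ('g \<Rightarrow> complex)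
     \<Rightarrow> 'p padic_bar poly" where
  "character_poly \<iota> S \<beta> \<psi> =
     of_nat (card S) * [:1, 1:] ^ nat (beta_max S \<beta>) -
     (\<Sum>s\<in>S. Polynomial.smult (\<iota> (\<psi> s)) ([:1, 1:] ^ nat (beta_max S \<beta> - padic_to_int (\<beta> s))))"

end

theory Submission
  imports Defs
begin

text \<open>The matrix with entries \<open>F (g\<^sub>i g\<^sub>j\<^sup>-\<^sup>1)\<close> has every character \<open>\<chi>\<close> of the group as an eigenvector, with
  eigenvalue \<open>\<Sum>\<^sub>x \<chi>(x\<^sup>-\<^sup>1) F(x)\<close>. By orthogonality \<open>|G|\<close> distinct characters form a basis, so the
  determinant is the product of these eigenvalues (Dedekind). That \<open>G\<close> has \<open>|G|\<close> complex characters is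
  deduced from the fact that they separate points: the translations of \<open>G\<close> are commuting operators of
  finite order on the functions \<open>G \<rightarrow> \<complex>\<close>, and the eigenvalues of a common eigenfunction form a
  character. For the matrix defining the Iwasawa polynomial the substitution \<open>s \<mapsto> s\<^sup>-\<^sup>1\<close> turns the
  eigenvalue of \<open>\<psi>\<close> into \<open>(1 + T)\<close> to the power \<open>- m\<^sub>\<beta>\<close> times \<open>P\<^sub>\<psi>\<close>; the unit is therefore \<open>1 + T\<close> to
  the power \<open>- |G| m\<^sub>\<beta>\<close>, which even has integer coefficients.\<close>

section \<open>Linear characters and their orthogonality\<close>

lemma sum_eq_0_if_bij_betw_scales:
  fixes f :: "'a \<Rightarrow> 'r::idom"
  assumes bij: "bij_betw h A A" and scale: "\<And>x. x \<in> A \<Longrightarrow> f (h x) = c * f x" and c: "c \<noteq> 1"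
  shows "sum f A = 0"
proof -
  have "sum f A = (\<Sum>x\<in>A. f (h x))" by (rule sum.reindex_bij_betw[OF bij, symmetric])
  also have "\<dots> = c * sum f A" by (simp add: scale sum_distrib_left)
  finally have "(c - 1) * sum f A = 0" by (simp add: algebra_simps)
  with c show ?thesis by simp
qed

definition linear_character :: "('g, 'm) monoid_scheme \<Rightarrow> ('g \<Rightarrow> 'r::comm_monoid_mult) \<Rightarrow> bool" where
  "linear_character G \<chi> \<longleftrightarrow>
     \<chi> \<one>\<^bsub>G\<^esub> = 1 \<and> (\<forall>x\<in>carrier G. \<forall>y\<in>carrier G. \<chi> (x \<otimes>\<^bsub>G\<^esub> y) = \<chi> x * \<chi> y)"

lemma linear_character_one: "linear_character G \<chi> \<Longrightarrow> \<chi> \<one>\<^bsub>G\<^esub> = 1"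
  by (simp add: linear_character_def)

lemma linear_character_mult:
  "linear_character G \<chi> \<Longrightarrow> x \<in> carrier G \<Longrightarrow> y \<in> carrier G \<Longrightarrow> \<chi> (x \<otimes>\<^bsub>G\<^esub> y) = \<chi> x * \<chi> y"
  by (simp add: linear_character_def)

lemma (in monoid) linear_character_pow:
  assumes "linear_character G \<chi>" "x \<in> carrier G"
  shows "\<chi> (x [^] (k::nat)) = \<chi> x ^ k"
  using assms
  by (induction k) (simp_all add: linear_character_one linear_character_mult mult.commute)

lemma (in group) linear_character_mult_inv:
  assumes "linear_character G \<chi>" "x \<in> carrier G"
  shows "\<chi> x * \<chi> (inv x) = 1"
  using linear_character_mult[OF assms inv_closed[OF assms(2)]] linear_character_one[OF assms(1)] assms(2)
  by simp

lemma (in group) linear_character_neq_0: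
  fixes \<chi> :: "'a \<Rightarrow> 'r::comm_semiring_1"
  assumes "linear_character G \<chi>" "x \<in> carrier G"
  shows "\<chi> x \<noteq> 0"
  using linear_character_mult_inv[OF assms] by auto

lemma (in group) bij_betw_mult_left:
  assumes "a \<in> carrier G"
  shows "bij_betw (\<lambda>x. a \<otimes> x) (carrier G) (carrier G)"
  using assms by (simp add: bij_betw_def inj_on_cmult surj_const_mult)

lemma (in comm_group) bij_betw_mult_inv:
  assumes "a \<in> carrier G"
  shows "bij_betw (\<lambda>x. a \<otimes> inv x) (carrier G) (carrier G)"
  by (rule bij_betwI[where g = "\<lambda>x. a \<otimes> inv x"]) (use assms in \<open>auto simp: inv_mult simp flip: m_assoc\<close>)

lemma (in group) mult_inv_eq_one_iff:
  assumes "x \<in> carrier G" "y \<in> carrier G"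
  shows "x \<otimes> inv y = \<one> \<longleftrightarrow> x = y"
  using assms by (metis inv_equality inv_inv inv_closed r_inv)

locale finite_comm_group = comm_group G for G (structure) +
  assumes finite_carrier [simp, intro]: "finite (carrier G)"
begin

lemma card_carrier_pos: "card (carrier G) > 0"
  using one_closed by (auto simp: card_gt_0_iff)

lemma pow_card_eq_one: "x \<in> carrier G \<Longrightarrow> x [^] card (carrier G) = \<one>"
  using pow_order_eq_1 by (simp add: Coset.order_def)

lemma linear_character_root_of_unity:
  assumes "linear_character G \<chi>" "x \<in> carrier G"
  shows "\<chi> x ^ card (carrier G) = 1"
  using assms by (metis linear_character_one linear_character_pow pow_card_eq_one)

lemma sum_linear_character:
  fixes \<chi> :: "'a \<Rightarrow> 'r::idom"
  assumes \<chi>: "linear_character G \<chi>"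
  shows "(\<Sum>x\<in>carrier G. \<chi> x) = (if \<forall>x\<in>carrier G. \<chi> x = 1 then of_nat (card (carrier G)) else 0)"
proof (cases "\<forall>x\<in>carrier G. \<chi> x = 1")
  case True
  then show ?thesis by simp
next
  case False
  then obtain a where a: "a \<in> carrier G" "\<chi> a \<noteq> 1" by blast
  have "(\<Sum>x\<in>carrier G. \<chi> x) = 0"
    using linear_character_mult[OF \<chi> a(1)] a(2)
    by (rule sum_eq_0_if_bij_betw_scales[OF bij_betw_mult_left[OF a(1)]])
  then show ?thesis unfolding if_not_P[OF False] .
qed

lemma linear_character_orthogonality:
  fixes \<chi> \<phi> :: "'a \<Rightarrow> 'r::idom"
  assumes \<chi>: "linear_character G \<chi>" and \<phi>: "linear_character G \<phi>"
  shows "(\<Sum>x\<in>carrier G. \<chi> (inv x) * \<phi> x) =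
    (if \<forall>x\<in>carrier G. \<chi> x = \<phi> x then of_nat (card (carrier G)) else 0)"
proof -
  have "linear_character G (\<lambda>x. \<chi> (inv x) * \<phi> x)"
    using \<chi> \<phi> by (simp add: linear_character_def inv_mult mult_ac)
  moreover have "\<chi> (inv x) * \<phi> x = 1 \<longleftrightarrow> \<chi> x = \<phi> x" if "x \<in> carrier G" for x
    using linear_character_mult_inv[OF \<chi> that] by (metis mult.commute mult.left_commute mult_1_right)
  ultimately show ?thesis by (simp add: sum_linear_character cong: ball_cong)
qed

end

section \<open>The group determinant\<close>

definition group_matrix :: "('g, 'm) monoid_scheme \<Rightarrow> (nat \<Rightarrow> 'g) \<Rightarrow> ('g \<Rightarrow> 'r) \<Rightarrow> 'r mat" where
  "group_matrix G g F = mat (card (carrier G)) (card (carrier G)) (\<lambda>(i, j). F (g i \<otimes>\<^bsub>G\<^esub> inv\<^bsub>G\<^esub> g j))"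

definition character_table ::
  "('g, 'm) monoid_scheme \<Rightarrow> (nat \<Rightarrow> 'g) \<Rightarrow> (nat \<Rightarrow> 'g \<Rightarrow> 'r) \<Rightarrow> 'r mat" where
  "character_table G g \<chi> = mat (card (carrier G)) (card (carrier G)) (\<lambda>(i, k). \<chi> k (g i))"

definition fourier_coeff ::
  "('g, 'm) monoid_scheme \<Rightarrow> ('g \<Rightarrow> 'r::comm_semiring_0) \<Rightarrow> ('g \<Rightarrow> 'r) \<Rightarrow> 'r" where
  "fourier_coeff G F \<chi> = (\<Sum>x\<in>carrier G. \<chi> (inv\<^bsub>G\<^esub> x) * F x)"

lemma group_matrix_carrier [simp]:
  "group_matrix G g F \<in> carrier_mat (card (carrier G)) (card (carrier G))"
  by (simp add: group_matrix_def)

lemma character_table_carrier [simp]: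
  "character_table G g \<chi> \<in> carrier_mat (card (carrier G)) (card (carrier G))"
  by (simp add: character_table_def)

lemma det_mat_diag: "Determinant.det (mat_diag n f) = (\<Prod>k<n. f k)"
proof -
  have "upper_triangular (mat_diag n f)" by (auto simp: mat_diag_def)
  then have "Determinant.det (mat_diag n f) = prod_list (diag_mat (mat_diag n f))"
    using mat_diag_dim by (rule det_upper_triangular)
  also have "\<dots> = (\<Prod>k<n. f k)"
    by (auto simp: prod_list_diag_prod mat_diag_def atLeast0LessThan intro!: prod.cong)
  finally show ?thesis .
qed

lemma (in comm_group) sum_convolution_linear_character:
  fixes \<chi> :: "'a \<Rightarrow> 'r::comm_semiring_1"
  assumes \<chi>: "linear_character G \<chi>" and a: "a \<in> carrier G"
  shows "(\<Sum>x\<in>carrier G. F (a \<otimes> inv x) * \<chi> x) = \<chi> a * fourier_coeff G F \<chi>"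
proof -
  have "(\<Sum>x\<in>carrier G. F (a \<otimes> inv x) * \<chi> x)
      = (\<Sum>y\<in>carrier G. F (a \<otimes> inv (a \<otimes> inv y)) * \<chi> (a \<otimes> inv y))"
    by (rule sum.reindex_bij_betw[OF bij_betw_mult_inv[OF a], symmetric])
  also have "\<dots> = (\<Sum>y\<in>carrier G. \<chi> a * (\<chi> (inv y) * F y))"
  proof (rule sum.cong[OF refl])
    fix y assume y: "y \<in> carrier G"
    have "a \<otimes> inv (a \<otimes> inv y) = y" using a y by (simp add: inv_mult flip: m_assoc)
    then show "F (a \<otimes> inv (a \<otimes> inv y)) * \<chi> (a \<otimes> inv y) = \<chi> a * (\<chi> (inv y) * F y)"
      using a y by (simp add: linear_character_mult[OF \<chi>] mult_ac)
  qed
  also have "\<dots> = \<chi> a * fourier_coeff G F \<chi>"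
    by (simp add: fourier_coeff_def sum_distrib_left)
  finally show ?thesis .
qed

context finite_comm_group
begin

context
  fixes g :: "nat \<Rightarrow> 'a"
  assumes g: "bij_betw g {..<card (carrier G)} (carrier G)"
begin

lemma sum_enumeration: "(\<Sum>i<card (carrier G). f (g i)) = (\<Sum>x\<in>carrier G. f x)"
  by (rule sum.reindex_bij_betw[OF g])

lemma enumeration_closed: "i < card (carrier G) \<Longrightarrow> g i \<in> carrier G"
  using g by (auto dest: bij_betwE)

lemma group_matrix_mult_character_table:
  fixes F :: "'a \<Rightarrow> 'r::comm_ring_1"
  assumes \<chi>: "\<And>k. k < card (carrier G) \<Longrightarrow> linear_character G (\<chi> k)"
  shows "group_matrix G g F * character_table G g \<chi> =
    character_table G g \<chi> * mat_diag (card (carrier G)) (\<lambda>k. fourier_coeff G F (\<chi> k))"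
proof (rule eq_matI)
  let ?n = "card (carrier G)"
  let ?D = "mat_diag ?n (\<lambda>k. fourier_coeff G F (\<chi> k))"
  fix i k assume "i < dim_row (character_table G g \<chi> * ?D)" "k < dim_col (character_table G g \<chi> * ?D)"
  then have ik: "i < ?n" "k < ?n" by (simp_all add: character_table_def mat_diag_def)
  have "(group_matrix G g F * character_table G g \<chi>) $$ (i, k) =
      (\<Sum>j<?n. F (g i \<otimes> inv g j) * \<chi> k (g j))"
    using ik by (simp add: group_matrix_def character_table_def scalar_prod_def atLeast0LessThan)
  also have "\<dots> = (\<Sum>x\<in>carrier G. F (g i \<otimes> inv x) * \<chi> k x)" by (rule sum_enumeration)
  also have "\<dots> = \<chi> k (g i) * fourier_coeff G F (\<chi> k)"
    using ik by (simp add: sum_convolution_linear_character \<chi> enumeration_closed)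
  also have "\<dots> = (character_table G g \<chi> * ?D) $$ (i, k)"
    unfolding mat_diag_mult_right[OF character_table_carrier]
    using ik by (simp add: character_table_def)
  finally show "(group_matrix G g F * character_table G g \<chi>) $$ (i, k) =
      (character_table G g \<chi> * ?D) $$ (i, k)" .
qed (simp_all add: group_matrix_def character_table_def mat_diag_def)

lemma det_character_table_neq_0:
  fixes \<chi> :: "nat \<Rightarrow> 'a \<Rightarrow> 'r::idom"
  assumes char: "of_nat (card (carrier G)) \<noteq> (0 :: 'r)"
    and \<chi>: "\<And>k. k < card (carrier G) \<Longrightarrow> linear_character G (\<chi> k)"
    and inj: "inj_on (\<lambda>k. restrict (\<chi> k) (carrier G)) {..<card (carrier G)}"
  shows "Determinant.det (character_table G g \<chi>) \<noteq> 0"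
proof -
  let ?n = "card (carrier G)"
  let ?V = "character_table G g \<chi>"
  let ?W = "mat ?n ?n (\<lambda>(k, i). \<chi> k (inv g i))"
  have "?W * ?V = mat_diag ?n (\<lambda>_. of_nat ?n)"
  proof (rule eq_matI)
    fix k l assume "k < dim_row (mat_diag ?n (\<lambda>_. of_nat ?n :: 'r))"
      "l < dim_col (mat_diag ?n (\<lambda>_. of_nat ?n :: 'r))"
    then have kl: "k < ?n" "l < ?n" by (simp_all add: mat_diag_def)
    have "(?W * ?V) $$ (k, l) = (\<Sum>i<?n. \<chi> k (inv g i) * \<chi> l (g i))"
      using kl by (simp add: character_table_def scalar_prod_def atLeast0LessThan)
    also have "\<dots> = (\<Sum>x\<in>carrier G. \<chi> k (inv x) * \<chi> l x)" by (rule sum_enumeration)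
    also have "\<dots> = (if \<forall>x\<in>carrier G. \<chi> k x = \<chi> l x then of_nat ?n else 0)"
      using kl by (simp add: linear_character_orthogonality \<chi>)
    also have "(\<forall>x\<in>carrier G. \<chi> k x = \<chi> l x) \<longleftrightarrow> restrict (\<chi> k) (carrier G) = restrict (\<chi> l) (carrier G)"
      by (metis restrict_apply' restrict_ext)
    also have "\<dots> \<longleftrightarrow> k = l" using inj_on_eq_iff[OF inj] kl by simp
    finally show "(?W * ?V) $$ (k, l) = mat_diag ?n (\<lambda>_. of_nat ?n) $$ (k, l)"
      using kl by (simp add: mat_diag_def)
  qed (simp_all add: character_table_def mat_diag_def)
  then have "Determinant.det ?W * Determinant.det ?V = of_nat ?n ^ ?n"
    by (simp add: det_mat_diag flip: det_mult[of _ ?n])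
  then show ?thesis using char by (metis mult_zero_right power_not_zero)
qed

theorem det_group_matrix:
  fixes F :: "'a \<Rightarrow> 'r::idom" and \<chi> :: "'i \<Rightarrow> 'a \<Rightarrow> 'r"
  assumes char: "of_nat (card (carrier G)) \<noteq> (0 :: 'r)"
    and I: "finite I" "card I = card (carrier G)"
    and \<chi>: "\<And>k. k \<in> I \<Longrightarrow> linear_character G (\<chi> k)"
    and inj: "inj_on (\<lambda>k. restrict (\<chi> k) (carrier G)) I"
  shows "Determinant.det (group_matrix G g F) = (\<Prod>k\<in>I. fourier_coeff G F (\<chi> k))"
proof -
  let ?n = "card (carrier G)"
  obtain e where e: "bij_betw e {..<?n} I"
    using ex_bij_betw_nat_finite[OF I(1)] I(2) by (auto simp: atLeast0LessThan)
  define \<chi>' where "\<chi>' k = \<chi> (e k)" for k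
  let ?A = "group_matrix G g F" and ?V = "character_table G g \<chi>'"
  let ?D = "mat_diag ?n (\<lambda>k. fourier_coeff G F (\<chi>' k))"
  have \<chi>': "linear_character G (\<chi>' k)" if "k < ?n" for k
    using \<chi> e that by (auto simp: \<chi>'_def dest: bij_betwE)
  have "inj_on (\<lambda>k. restrict (\<chi>' k) (carrier G)) {..<?n}"
    using comp_inj_on[OF bij_betw_imp_inj_on[OF e]] inj
    by (simp add: comp_def \<chi>'_def bij_betw_imp_surj_on[OF e])
  with char \<chi>' have "Determinant.det ?V \<noteq> 0" by (rule det_character_table_neq_0)
  moreover have "Determinant.det ?A * Determinant.det ?V = Determinant.det ?V * Determinant.det ?D"
    using group_matrix_mult_character_table[OF \<chi>', where F = F] by (simp flip: det_mult[of _ ?n])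
  ultimately have "Determinant.det ?A = Determinant.det ?D" by (metis mult.commute mult_cancel_left)
  also have "\<dots> = (\<Prod>k<?n. fourier_coeff G F (\<chi> (e k)))" by (simp add: det_mat_diag \<chi>'_def)
  also have "\<dots> = (\<Prod>k\<in>I. fourier_coeff G F (\<chi> k))" by (rule prod.reindex_bij_betw[OF e])
  finally show ?thesis .
qed

end

end

section \<open>Translation eigenfunctions and the number of characters\<close>

lemma sum_roots_unity_power:
  assumes "i < n"
  shows "(\<Sum>\<omega> | \<omega> ^ n = 1. \<omega> ^ i) = (if i = 0 then of_nat n else 0 :: complex)"
proof (cases "i = 0")
  case True
  then show ?thesis using assms by (simp add: card_roots_unity_eq)
next
  case False
  let ?R = "{\<omega>::complex. \<omega> ^ n = 1}"
  have "\<not> ?R \<subseteq> {\<omega>. \<omega> ^ i = 1}"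
    using card_mono[OF finite_nth_roots[of i 1], of ?R] assms False by (auto simp: card_roots_unity_eq)
  then obtain \<zeta> :: complex where \<zeta>: "\<zeta> ^ n = 1" "\<zeta> ^ i \<noteq> 1" by blast
  then have "\<zeta> \<noteq> 0" using assms by (auto simp: power_0_left)
  then have "bij_betw (\<lambda>\<omega>. \<zeta> * \<omega>) ?R ?R"
    using \<zeta>(1)
    by (intro bij_betwI[where g = "\<lambda>\<omega>. \<omega> / \<zeta>"]) (auto simp: power_mult_distrib power_divide)
  then have "(\<Sum>\<omega>\<in>?R. \<omega> ^ i) = 0"
    using power_mult_distrib \<zeta>(2) by (rule sum_eq_0_if_bij_betw_scales)
  with False show ?thesis by simp
qed

definition translation_eigenfunction ::
  "('g, 'm) monoid_scheme \<Rightarrow> 'g \<Rightarrow> 'r::comm_semiring_0 \<Rightarrow> ('g \<Rightarrow> 'r) \<Rightarrow> bool" where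
  "translation_eigenfunction G a c f \<longleftrightarrow> (\<forall>z\<in>carrier G. f (a \<otimes>\<^bsub>G\<^esub> z) = c * f z)"

text \<open>For \<open>\<omega>\<close> with \<open>\<omega>\<^bsup>|G|\<^esup> = 1\<close> this is, up to a factor \<open>|G|\<close>, the projection of \<open>f\<close> onto the
  \<open>\<omega>\<^sup>-\<^sup>1\<close>-eigenspace of translation by \<open>x\<close>.\<close>

definition twisted_average ::
  "('g, 'm) monoid_scheme \<Rightarrow> 'g \<Rightarrow> 'r::comm_semiring_1 \<Rightarrow> ('g \<Rightarrow> 'r) \<Rightarrow> 'g \<Rightarrow> 'r" where
  "twisted_average G x \<omega> f z = (\<Sum>i<card (carrier G). \<omega> ^ i * f (x [^]\<^bsub>G\<^esub> i \<otimes>\<^bsub>G\<^esub> z))"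

lemma (in group) linear_character_eigenvalues:
  fixes f :: "'a \<Rightarrow> 'r::idom"
  assumes "z \<in> carrier G" "f z \<noteq> 0"
    and eigen: "\<And>a. a \<in> carrier G \<Longrightarrow> translation_eigenfunction G a (c a) f"
  shows "linear_character G c"
proof -
  have f: "f (a \<otimes> y) = c a * f y" if "a \<in> carrier G" "y \<in> carrier G" for a y
    using eigen that by (simp add: translation_eigenfunction_def)
  have "c (a \<otimes> b) * f z = c a * c b * f z" if "a \<in> carrier G" "b \<in> carrier G" for a b
    using that assms(1) by (simp add: m_assoc mult.assoc flip: f)
  moreover have "c \<one> * f z = f z" using assms(1) by (simp flip: f)
  ultimately show ?thesis using assms(2) by (simp add: linear_character_def)
qed

context finite_comm_group
begin

lemma translation_eigenfunction_twisted_average: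
  fixes f :: "'a \<Rightarrow> 'r::field"
  assumes x: "x \<in> carrier G" and \<omega>: "\<omega> ^ card (carrier G) = 1"
  shows "translation_eigenfunction G x (inverse \<omega>) (twisted_average G x \<omega> f)"
  unfolding translation_eigenfunction_def
proof
  let ?n = "card (carrier G)"
  fix z assume z: "z \<in> carrier G"
  define a where "a i = \<omega> ^ i * f (x [^] i \<otimes> z)" for i :: nat
  have "\<omega> \<noteq> 0" using \<omega> card_carrier_pos by (metis power_0_left less_irrefl zero_neq_one)
  have "\<omega> * twisted_average G x \<omega> f (x \<otimes> z) = (\<Sum>i<?n. a (Suc i))"
    using x z by (simp add: twisted_average_def a_def sum_distrib_left m_assoc mult.assoc)
  also have "\<dots> = (\<Sum>i<?n. a i)"
  proof -
    have "a ?n = a 0" using x \<omega> by (simp add: a_def pow_card_eq_one)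
    then show ?thesis
      using sum.lessThan_Suc_shift[of a ?n] sum.lessThan_Suc[of a ?n] by simp
  qed
  also have "\<dots> = twisted_average G x \<omega> f z" by (simp add: a_def twisted_average_def)
  finally show "twisted_average G x \<omega> f (x \<otimes> z) = inverse \<omega> * twisted_average G x \<omega> f z"
    using \<open>\<omega> \<noteq> 0\<close> by (simp add: field_simps)
qed

lemma translation_eigenfunction_twisted_average_preserved:
  assumes "translation_eigenfunction G a c f" "a \<in> carrier G" "x \<in> carrier G"
  shows "translation_eigenfunction G a c (twisted_average G x \<omega> f)"
  unfolding translation_eigenfunction_def
proof
  fix z assume z: "z \<in> carrier G"
  have "f (x [^] i \<otimes> (a \<otimes> z)) = c * f (x [^] i \<otimes> z)" for i :: nat
    using assms z by (simp add: m_lcomm translation_eigenfunction_def)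
  then show "twisted_average G x \<omega> f (a \<otimes> z) = c * twisted_average G x \<omega> f z"
    by (simp add: twisted_average_def sum_distrib_left mult_ac)
qed

lemma sum_twisted_average:
  fixes f :: "'a \<Rightarrow> complex"
  assumes "z \<in> carrier G"
  shows "(\<Sum>\<omega> | \<omega> ^ card (carrier G) = 1. twisted_average G x \<omega> f z) = of_nat (card (carrier G)) * f z"
proof -
  let ?n = "card (carrier G)"
  have "(\<Sum>\<omega> | \<omega> ^ ?n = 1. twisted_average G x \<omega> f z) =
      (\<Sum>i<?n. (\<Sum>\<omega> | \<omega> ^ ?n = 1. \<omega> ^ i) * f (x [^] i \<otimes> z))"
    unfolding twisted_average_def sum_distrib_right by (rule sum.swap)
  also have "\<dots> = (\<Sum>i<?n. if i = 0 then of_nat ?n * f z else 0)"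
    using assms by (intro sum.cong refl) (simp add: sum_roots_unity_power)
  also have "\<dots> = of_nat ?n * f z" using card_carrier_pos by simp
  finally show ?thesis .
qed

lemma exists_twisted_average_neq_0:
  fixes f :: "'a \<Rightarrow> complex"
  assumes "z \<in> carrier G" "f z \<noteq> 0"
  shows "\<exists>\<omega>. \<omega> ^ card (carrier G) = 1 \<and> twisted_average G x \<omega> f z \<noteq> 0"
proof (rule ccontr)
  assume "\<not> ?thesis"
  then have "(\<Sum>\<omega> | \<omega> ^ card (carrier G) = 1. twisted_average G x \<omega> f z) = 0"
    by (intro sum.neutral) blast
  then show False using sum_twisted_average[OF assms(1)] assms(2) card_carrier_pos by simp
qed

lemma exists_twisted_average_neq_0_nontrivial:
  fixes f :: "'a \<Rightarrow> complex"
  assumes x: "x \<in> carrier G" and z: "z \<in> carrier G" and f: "f (x \<otimes> z) \<noteq> f z"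
  shows "\<exists>\<omega>. \<omega> ^ card (carrier G) = 1 \<and> \<omega> \<noteq> 1 \<and> twisted_average G x \<omega> f z \<noteq> 0"
proof (rule ccontr)
  let ?R = "{\<omega>::complex. \<omega> ^ card (carrier G) = 1}"
  assume "\<not> ?thesis"
  then have "twisted_average G x \<omega> f (x \<otimes> z) = twisted_average G x \<omega> f z" if "\<omega> \<in> ?R" for \<omega>
    using translation_eigenfunction_twisted_average[OF x, of \<omega> f] z that
    by (cases "\<omega> = 1") (auto simp: translation_eigenfunction_def)
  then have "(\<Sum>\<omega>\<in>?R. twisted_average G x \<omega> f (x \<otimes> z)) = (\<Sum>\<omega>\<in>?R. twisted_average G x \<omega> f z)"
    by (rule sum.cong[OF refl])
  then show False using sum_twisted_average x z f card_carrier_pos by simp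
qed

lemma exists_common_eigenfunction:
  fixes f :: "'a \<Rightarrow> complex"
  assumes "A \<subseteq> carrier G" and f: "z \<in> carrier G" "f z \<noteq> 0"
    and x: "x \<in> carrier G" "translation_eigenfunction G x d f"
  shows "\<exists>h c. h z \<noteq> 0 \<and> translation_eigenfunction G x d h \<and>
    (\<forall>a\<in>A. translation_eigenfunction G a (c a) h)"
proof -
  have "finite A" using assms(1) finite_carrier by (rule finite_subset)
  then show ?thesis using assms(1)
  proof (induction A rule: finite_induct)
    case empty
    show ?case using f x(2) by blast
  next
    case (insert b A)
    then obtain h c where h: "h z \<noteq> 0" "translation_eigenfunction G x d h"
        "\<forall>a\<in>A. translation_eigenfunction G a (c a) h"
      by blast
    obtain \<omega> where \<omega>: "\<omega> ^ card (carrier G) = 1" "twisted_average G b \<omega> h z \<noteq> 0"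
      using exists_twisted_average_neq_0[of z h b] f(1) h(1) by blast
    let ?h = "twisted_average G b \<omega> h"
    have "translation_eigenfunction G x d ?h"
      using translation_eigenfunction_twisted_average_preserved h(2) x(1) insert.prems by blast
    moreover have "translation_eigenfunction G a ((c(b := inverse \<omega>)) a) ?h" if "a \<in> insert b A" for a
    proof (cases "a = b")
      case True
      then show ?thesis
        using translation_eigenfunction_twisted_average[OF _ \<omega>(1)] insert.prems by simp
    next
      case False
      with that have "a \<in> A" by simp
      then have "translation_eigenfunction G a (c a) ?h"
        using translation_eigenfunction_twisted_average_preserved h(3) insert.prems by blast
      then show ?thesis using False by simp
    qed
    ultimately show ?case using \<omega>(2) by blast
  qed
qed

lemma mem_characters_iff: "\<psi> \<in> characters G \<longleftrightarrow> \<psi> \<in> extensional (carrier G) \<and> linear_character G \<psi>"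
proof
  assume \<psi>: "\<psi> \<in> characters G"
  then have mult: "\<forall>x\<in>carrier G. \<forall>y\<in>carrier G. \<psi> (x \<otimes> y) = \<psi> x * \<psi> y" and "\<psi> \<one> \<noteq> 0"
    by (auto simp: characters_def hom_def complex_units_def Pi_iff)
  from mult have "\<psi> \<one> * \<psi> \<one> = \<psi> \<one>" by (metis one_closed r_one)
  with \<open>\<psi> \<one> \<noteq> 0\<close> have "\<psi> \<one> = 1" by simp
  with \<psi> show "\<psi> \<in> extensional (carrier G) \<and> linear_character G \<psi>"
    by (auto simp: characters_def hom_def complex_units_def linear_character_def)
next
  assume \<psi>: "\<psi> \<in> extensional (carrier G) \<and> linear_character G \<psi>"
  then have "\<psi> x \<noteq> 0" if "x \<in> carrier G" for x
    using linear_character_neq_0 that by blast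
  with \<psi> show "\<psi> \<in> characters G"
    by (auto simp: characters_def hom_def complex_units_def linear_character_def)
qed

lemma exists_character_neq_1:
  assumes x: "x \<in> carrier G" "x \<noteq> \<one>"
  shows "\<exists>\<psi>\<in>characters G. \<psi> x \<noteq> 1"
proof -
  define \<delta> :: "'a \<Rightarrow> complex" where "\<delta> z = (if z = \<one> then 1 else 0)" for z
  have "\<delta> (x \<otimes> \<one>) \<noteq> \<delta> \<one>" using x by (simp add: \<delta>_def)
  then obtain \<omega> where \<omega>: "\<omega> ^ card (carrier G) = 1" "\<omega> \<noteq> 1" "twisted_average G x \<omega> \<delta> \<one> \<noteq> 0"
    using exists_twisted_average_neq_0_nontrivial[OF x(1) one_closed] by blast
  obtain h c where h: "h \<one> \<noteq> 0" "translation_eigenfunction G x (inverse \<omega>) h"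
      "\<forall>a\<in>carrier G. translation_eigenfunction G a (c a) h"
    using exists_common_eigenfunction[OF subset_refl one_closed, of "twisted_average G x \<omega> \<delta>"] \<omega>(3) x(1)
      translation_eigenfunction_twisted_average[OF x(1) \<omega>(1)] by blast
  have "linear_character G c" using linear_character_eigenvalues[of \<one> h c] h(1,3) one_closed by blast
  then have "restrict c (carrier G) \<in> characters G"
    by (simp add: mem_characters_iff linear_character_def)
  moreover have "c x * h \<one> = inverse \<omega> * h \<one>"
    using h(2,3) x(1) unfolding translation_eigenfunction_def by (metis one_closed)
  then have "c x \<noteq> 1" using h(1) \<omega>(2) by auto
  ultimately show ?thesis using x(1) by (intro bexI[of _ "restrict c (carrier G)"]) auto
qed

lemma finite_characters: "finite (characters G)"
proof (rule finite_subset)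
  let ?R = "{z::complex. z ^ card (carrier G) = 1}"
  show "characters G \<subseteq> carrier G \<rightarrow>\<^sub>E ?R"
    unfolding PiE_def by (auto simp: mem_characters_iff linear_character_root_of_unity)
  show "finite (carrier G \<rightarrow>\<^sub>E ?R)"
    using card_carrier_pos by (intro finite_PiE finite_nth_roots) auto
qed

lemma sum_characters:
  assumes x: "x \<in> carrier G"
  shows "(\<Sum>\<psi>\<in>characters G. \<psi> x) = (if x = \<one> then of_nat (card (characters G)) else 0)"
proof (cases "x = \<one>")
  case True
  then show ?thesis by (simp add: mem_characters_iff linear_character_one)
next
  case False
  then obtain \<phi> where \<phi>: "\<phi> \<in> characters G" "\<phi> x \<noteq> 1"
    using exists_character_neq_1[OF x] by blast
  have "\<phi> y \<noteq> 0" if "y \<in> carrier G" for y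
    using linear_character_neq_0 \<phi>(1) that by (auto simp: mem_characters_iff)
  then have twist: "bij_betw (\<lambda>\<psi>. restrict (\<lambda>y. \<phi> y * \<psi> y) (carrier G)) (characters G) (characters G)"
    using \<phi>(1)
    by (intro bij_betwI[where g = "\<lambda>\<psi>. restrict (\<lambda>y. inverse (\<phi> y) * \<psi> y) (carrier G)"])
      (auto simp: mem_characters_iff linear_character_def extensional_def fun_eq_iff)
  have "(\<Sum>\<psi>\<in>characters G. \<psi> x) = 0"
    using x \<phi>(2) by (intro sum_eq_0_if_bij_betw_scales[where c = "\<phi> x", OF twist]) simp_all
  with False show ?thesis by simp
qed

theorem card_characters: "card (characters G) = card (carrier G)"
proof -
  let ?triv = "restrict (\<lambda>_. 1 :: complex) (carrier G)"
  have "(\<forall>x\<in>carrier G. \<psi> x = 1) \<longleftrightarrow> \<psi> = ?triv" if "\<psi> \<in> characters G" for \<psi>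
    using that by (auto simp: mem_characters_iff extensional_def fun_eq_iff)
  then have sum_character: "(\<Sum>x\<in>carrier G. \<psi> x) = (if \<psi> = ?triv then of_nat (card (carrier G)) else 0)"
    if "\<psi> \<in> characters G" for \<psi>
    using that by (simp add: mem_characters_iff sum_linear_character)
  have "complex_of_nat (card (characters G)) = (\<Sum>x\<in>carrier G. \<Sum>\<psi>\<in>characters G. \<psi> x)"
    by (simp add: sum_characters)
  also have "\<dots> = (\<Sum>\<psi>\<in>characters G. \<Sum>x\<in>carrier G. \<psi> x)" by (rule sum.swap)
  also have "\<dots> = of_nat (card (carrier G))"
    using finite_characters by (simp add: sum_character mem_characters_iff linear_character_def)
  finally show ?thesis by (simp only: of_nat_eq_iff)
qed

end

section \<open>Embedded characters\<close>

lemma algebraic_root_of_unity: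
  assumes "z ^ n = 1" "n > 0"
  shows "Polynomial.algebraic (z :: 'a::field_char_0)"
proof (rule algebraic_root)
  show "poly (Polynomial.monom 1 n) z = 1" using assms(1) by (simp add: poly_monom)
qed (use assms(2) in \<open>simp_all add: degree_monom_eq\<close>)

lemma algebraic_diff_Ints:
  assumes "Polynomial.algebraic (x :: 'a::field_char_0)" "c \<in> \<int>"
  shows "Polynomial.algebraic (x - c)"
proof -
  obtain p where p: "\<And>i. Polynomial.coeff p i \<in> \<int>" "p \<noteq> 0" "poly p x = 0"
    using algebraicE[OF assms(1)] by blast
  show ?thesis
  proof (rule algebraicI)
    show "Polynomial.coeff (p \<circ>\<^sub>p [:c, 1:]) i \<in> \<int>" for i
      using p(1) assms(2)
      by (intro coeff_pcompose_semiring_closed) (auto simp: coeff_pCons split: nat.splits)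
    show "p \<circ>\<^sub>p [:c, 1:] \<noteq> 0" using p(2) by (simp add: pcompose_eq_0_iff)
    show "poly (p \<circ>\<^sub>p [:c, 1:]) (x - c) = 0" using p(3) by (simp add: poly_pcompose)
  qed
qed

lemma algebraic_embedding_one: "algebraic_embedding \<iota> \<Longrightarrow> \<iota> 1 = 1"
  by (simp add: algebraic_embedding_def)

lemma algebraic_embedding_mult:
  assumes "algebraic_embedding \<iota>" "Polynomial.algebraic x" "Polynomial.algebraic y"
  shows "\<iota> (x * y) = \<iota> x * \<iota> y"
  using assms by (simp add: algebraic_embedding_def)

lemma algebraic_embedding_eq_1D:
  assumes \<iota>: "algebraic_embedding \<iota>" and x: "Polynomial.algebraic x" "\<iota> x = 1"
  shows "x = 1"
proof (rule ccontr)
  assume "x \<noteq> 1"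
  have alg: "Polynomial.algebraic (x - 1)" using x(1) by (intro algebraic_diff_Ints) auto
  then have "\<iota> (1 + (x - 1)) = \<iota> 1 + \<iota> (x - 1)"
    using \<iota> algebraic_1 unfolding algebraic_embedding_def by blast
  then have "\<iota> (x - 1) = 0" using x(2) by (simp add: algebraic_embedding_one[OF \<iota>])
  moreover have "\<iota> ((x - 1) * inverse (x - 1)) = \<iota> (x - 1) * \<iota> (inverse (x - 1))"
    using \<iota> alg by (intro algebraic_embedding_mult) auto
  ultimately show False using \<open>x \<noteq> 1\<close> by (simp add: algebraic_embedding_one[OF \<iota>])
qed

lemma inj_on_algebraic_embedding_roots_of_unity:
  assumes \<iota>: "algebraic_embedding \<iota>" and n: "n > 0"
  shows "inj_on \<iota> {z. z ^ n = 1}"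
proof (rule inj_onI, unfold mem_Collect_eq)
  fix z w assume zw: "z ^ n = 1" "w ^ n = 1" "\<iota> z = \<iota> w"
  have alg: "Polynomial.algebraic z" "Polynomial.algebraic w" "Polynomial.algebraic (z * inverse w)"
    using zw n by (auto intro!: algebraic_root_of_unity[of _ n] simp: power_mult_distrib power_inverse)
  have "w \<noteq> 0" using zw(2) n by (auto simp: power_0_left)
  have "\<iota> (z * inverse w) = \<iota> (w * inverse w)"
    using alg zw(3) by (simp add: algebraic_embedding_mult[OF \<iota>] algebraic_inverse)
  then have "\<iota> (z * inverse w) = 1" using \<open>w \<noteq> 0\<close> by (simp add: algebraic_embedding_one[OF \<iota>])
  then show "z = w" using algebraic_embedding_eq_1D[OF \<iota> alg(3)] \<open>w \<noteq> 0\<close> by (simp add: field_simps)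
qed

context finite_comm_group
begin

lemma linear_character_algebraic_embedding:
  assumes \<iota>: "algebraic_embedding \<iota>" and \<chi>: "linear_character G \<chi>"
  shows "linear_character G (\<lambda>x. \<iota> (\<chi> x))"
proof -
  have "Polynomial.algebraic (\<chi> x)" if "x \<in> carrier G" for x
    using linear_character_root_of_unity[OF \<chi> that] card_carrier_pos by (rule algebraic_root_of_unity)
  then show ?thesis
    using \<chi> by (simp add: linear_character_def algebraic_embedding_one[OF \<iota>] algebraic_embedding_mult[OF \<iota>])
qed

lemma linear_character_fps_const_embedding:
  assumes "algebraic_embedding \<iota>" "\<psi> \<in> characters G"
  shows "linear_character G (\<lambda>x. fps_const (\<iota> (\<psi> x)))"
  using linear_character_algebraic_embedding[OF assms(1), of \<psi>] assms(2)
  by (simp add: mem_characters_iff linear_character_def)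

lemma det_group_matrix_characters:
  fixes F :: "'a \<Rightarrow> 'f::field_char_0 fps"
  assumes \<iota>: "algebraic_embedding \<iota>" and g: "bij_betw g {..<card (carrier G)} (carrier G)"
  shows "Determinant.det (group_matrix G g F) =
    (\<Prod>\<psi>\<in>characters G. fourier_coeff G F (\<lambda>x. fps_const (\<iota> (\<psi> x))))"
proof (rule det_group_matrix[OF g])
  show "of_nat (card (carrier G)) \<noteq> (0 :: 'f fps)" using card_carrier_pos by (simp add: card_gt_0_iff)
  show "linear_character G (\<lambda>x. fps_const (\<iota> (\<psi> x)))" if "\<psi> \<in> characters G" for \<psi>
    using linear_character_fps_const_embedding[OF \<iota> that] .
  show "inj_on (\<lambda>\<psi>. restrict (\<lambda>x. fps_const (\<iota> (\<psi> x))) (carrier G)) (characters G)"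
  proof (rule inj_onI, rule extensionalityI)
    fix \<psi> \<phi> x assume \<psi>: "\<psi> \<in> characters G" and \<phi>: "\<phi> \<in> characters G" and x: "x \<in> carrier G"
      and "restrict (\<lambda>x. fps_const (\<iota> (\<psi> x))) (carrier G) = restrict (\<lambda>x. fps_const (\<iota> (\<phi> x))) (carrier G)"
    then have "fps_const (\<iota> (\<psi> x)) = fps_const (\<iota> (\<phi> x))" by (metis restrict_apply')
    then have "\<iota> (\<psi> x) = \<iota> (\<phi> x)" by (metis fps_nth_fps_const)
    then show "\<psi> x = \<phi> x"
    proof (rule inj_onD[OF inj_on_algebraic_embedding_roots_of_unity[OF \<iota> card_carrier_pos]])
    qed (use \<psi> \<phi> x in \<open>simp_all add: mem_characters_iff linear_character_root_of_unity\<close>)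
  qed (simp_all add: mem_characters_iff)
qed (simp_all add: finite_characters card_characters)

end

section \<open>Powers of \<open>1 + T\<close> over the valuation ring\<close>

lemma one_plus_T_powi_eq_fps_binomial:
  "(one_plus_T_powi b :: 'a::field_char_0 fps) = fps_binomial (of_int b)"
  by (simp add: one_plus_T_powi_def fps_eq_iff of_int_int_binomial_coeff)

lemma one_plus_T_powi_0 [simp]: "(one_plus_T_powi 0 :: 'a::field_char_0 fps) = 1"
  by (simp add: one_plus_T_powi_eq_fps_binomial)

lemma one_plus_T_powi_add:
  "(one_plus_T_powi (a + b) :: 'a::field_char_0 fps) = one_plus_T_powi a * one_plus_T_powi b"
  by (simp add: one_plus_T_powi_eq_fps_binomial fps_binomial_add_mult)

lemma one_plus_T_powi_power:
  "(one_plus_T_powi a :: 'a::field_char_0 fps) ^ n = one_plus_T_powi (int n * a)"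
  by (simp add: one_plus_T_powi_eq_fps_binomial fps_binomial_power)

lemma fps_of_poly_one_plus_T_power:
  assumes "b \<ge> 0"
  shows "fps_of_poly ([:1, 1:] ^ nat b) = (one_plus_T_powi b :: 'a::field_char_0 fps)"
proof -
  have "(of_int b :: 'a) = of_nat (nat b)" using assms by simp
  then show ?thesis
    by (simp add: one_plus_T_powi_eq_fps_binomial fps_binomial_of_nat fps_of_poly_power
      fps_of_poly_pCons)
qed

lemma one_plus_T_powi_in_fps_units_over:
  assumes "range of_int \<subseteq> R"
  shows "(one_plus_T_powi b :: 'a::field_char_0 fps) \<in> fps_units_over R"
proof -
  have "(one_plus_T_powi c :: 'a fps) \<in> fps_over R" for c
    using assms by (auto simp: fps_over_def one_plus_T_powi_def)
  moreover have "one_plus_T_powi b * one_plus_T_powi (- b) = (1 :: 'a fps)"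
    by (simp flip: one_plus_T_powi_add)
  ultimately show ?thesis unfolding fps_units_over_def by blast
qed

interpretation padic_int_to_bar: comm_ring_hom padic_int_to_bar
  by unfold_locales
    (simp_all add: padic_int_to_bar_def Zero_fract_def[symmetric] One_fract_def[symmetric]
      flip: to_ac_add to_ac_mult)

interpretation fps_to_bar: comm_ring_hom fps_to_bar
  by unfold_locales
    (simp_all add: fps_to_bar_def fps_eq_iff fps_mult_nth padic_int_to_bar.hom_add
      padic_int_to_bar.hom_mult padic_int_to_bar.hom_sum)

lemma fps_to_bar_one_plus_T_powi: "fps_to_bar (one_plus_T_powi b) = one_plus_T_powi b"
  by (simp add: fps_to_bar_def one_plus_T_powi_def padic_int_to_bar.hom_of_int)

lemma padic_int_abs_1: "padic_int_abs (1 :: 'p::prime_card padic_int) = 1"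
  using padic_int_abs_mult[of 1 "1 :: 'p padic_int"] padic_int_abs_eq_0_iff[of "1 :: 'p padic_int"]
  by simp

lemma padic_int_abs_le_1: "padic_int_abs (x :: 'p::prime_card padic_int) \<le> 1"
  using prime_gt_0_nat[OF prime_card[where 'a='p]]
  by (auto simp: padic_int_abs_def divide_le_eq_1 simp flip: of_nat_power)

lemma padic_int_to_bar_in_valuation_ring:
  assumes "range to_ac \<subseteq> K"
  shows "padic_int_to_bar x \<in> padic_valuation_ring K"
proof -
  have "padic_bar_abs (padic_int_to_bar x) \<le> 1"
    by (simp add: padic_int_to_bar_def padic_bar_abs_to_ac padic_abs_Fract padic_int_abs_1
      padic_int_abs_le_1)
  then show ?thesis using assms by (auto simp: padic_valuation_ring_def padic_int_to_bar_def)
qed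

lemma range_of_int_subset_valuation_ring:
  fixes K :: "'p::prime_card padic_bar set"
  assumes "range to_ac \<subseteq> K"
  shows "range of_int \<subseteq> padic_valuation_ring K"
proof (rule image_subsetI)
  fix k :: int
  show "(of_int k :: 'p padic_bar) \<in> padic_valuation_ring K"
    using padic_int_to_bar_in_valuation_ring[OF assms, of "of_int k"]
    by (simp add: padic_int_to_bar.hom_of_int)
qed

lemma range_to_ac_subset_cyclotomic_padic_field: "range to_ac \<subseteq> cyclotomic_padic_field n"
  unfolding cyclotomic_padic_field_def by (rule subsetI, rule generate_field.incl) (rule UnI1)

section \<open>The twisted Laplacian of a Cayley graph\<close>

definition cayley_laplacian ::
  "('g, 'm) monoid_scheme \<Rightarrow> 'g set \<Rightarrow> ('g \<Rightarrow> 'p::prime_card padic_int) \<Rightarrow> 'g \<Rightarrow> 'c::comm_ring_1 fps" where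
  "cayley_laplacian G S \<beta> x = (if x = \<one>\<^bsub>G\<^esub> then of_nat (card S) else 0) -
     (if x \<in> S then one_plus_T_powi (padic_to_int (\<beta> x)) else 0)"

lemma fps_to_bar_cayley_laplacian: "fps_to_bar (cayley_laplacian G S \<beta> x) = cayley_laplacian G S \<beta> x"
  by (simp add: cayley_laplacian_def fps_to_bar.hom_minus fps_to_bar.hom_of_nat
    fps_to_bar_one_plus_T_powi)

locale symmetric_integral_weight = finite_comm_group G for G (structure) +
  fixes S :: "'a set" and \<beta> :: "'a \<Rightarrow> 'p::prime_card padic_int"
  assumes S_subset: "S \<subseteq> carrier G" and S_nonempty: "S \<noteq> {}" and inv_image_S: "m_inv G ` S = S"
    and \<beta>_integral: "\<beta> ` S \<subseteq> \<int>" and \<beta>_inv: "s \<in> S \<Longrightarrow> \<beta> (inv s) = - \<beta> s"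
begin

lemma finite_S: "finite S"
  using S_subset finite_carrier by (rule finite_subset)

lemma padic_to_int_\<beta>_inv:
  assumes "s \<in> S"
  shows "padic_to_int (\<beta> (inv s)) = - padic_to_int (\<beta> s)"
proof -
  obtain b where "\<beta> s = of_int b" using \<beta>_integral assms by (auto elim: Ints_cases)
  then show ?thesis using \<beta>_inv[OF assms] by (simp flip: of_int_minus)
qed

lemma padic_to_int_\<beta>_le_beta_max: "s \<in> S \<Longrightarrow> padic_to_int (\<beta> s) \<le> beta_max S \<beta>"
  unfolding beta_max_def using finite_S by simp

lemma beta_max_nonneg: "beta_max S \<beta> \<ge> 0"
proof -
  obtain s where s: "s \<in> S" using S_nonempty by blast
  then have "inv s \<in> S" using inv_image_S by blast
  then show ?thesis
    using padic_to_int_\<beta>_le_beta_max[of s] padic_to_int_\<beta>_le_beta_max[of "inv s"]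
      padic_to_int_\<beta>_inv s by simp
qed

lemma bij_betw_inv_S: "bij_betw (m_inv G) S S"
  using inv_image_S S_subset by (auto simp: bij_betw_def inj_on_def subset_iff dest: inv_eq_imp_eq)

lemma iwasawa_poly_eq_det_group_matrix:
  assumes g: "bij_betw g {..<card (carrier G)} (carrier G)"
  shows "iwasawa_poly (cayley_graph G S) (cayley_voltage G \<beta>) g =
    Determinant.det (group_matrix G g (cayley_laplacian G S \<beta>))"
proof -
  have "g i \<otimes> inv g j = \<one> \<longleftrightarrow> i = j" if "i < card (carrier G)" "j < card (carrier G)" for i j
    using that g enumeration_closed[OF g]
    by (simp add: mult_inv_eq_one_iff inj_on_eq_iff[OF bij_betw_imp_inj_on[OF g]])
  then show ?thesis
    unfolding iwasawa_poly_cayley[OF comm_group_axioms S_subset inv_image_S g] group_matrix_def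
    by (intro arg_cong[where f = Determinant.det] cong_mat refl) (simp add: cayley_laplacian_def)
qed

lemma fps_to_bar_iwasawa_poly:
  assumes g: "bij_betw g {..<card (carrier G)} (carrier G)"
  shows "fps_to_bar (iwasawa_poly (cayley_graph G S) (cayley_voltage G \<beta>) g) =
    Determinant.det (group_matrix G g (cayley_laplacian G S \<beta>))"
proof -
  have "map_mat fps_to_bar (group_matrix G g (cayley_laplacian G S \<beta> :: 'a \<Rightarrow> 'p padic_int fps)) =
      group_matrix G g (cayley_laplacian G S \<beta>)"
    by (rule eq_matI) (simp_all add: group_matrix_def fps_to_bar_cayley_laplacian)
  then show ?thesis
    by (simp add: iwasawa_poly_eq_det_group_matrix[OF g] flip: fps_to_bar.hom_det)
qed

lemma fourier_coeff_cayley_laplacian: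
  fixes \<chi> :: "'a \<Rightarrow> 'c::comm_ring_1 fps"
  assumes "linear_character G \<chi>"
  shows "fourier_coeff G (cayley_laplacian G S \<beta>) \<chi> =
    of_nat (card S) - (\<Sum>s\<in>S. \<chi> s * one_plus_T_powi (- padic_to_int (\<beta> s)))"
proof -
  let ?b = "\<lambda>s. padic_to_int (\<beta> s)"
  have "fourier_coeff G (cayley_laplacian G S \<beta>) \<chi> =
      (\<Sum>x\<in>carrier G. if x = \<one> then of_nat (card S) else 0) -
      (\<Sum>x\<in>carrier G. if x \<in> S then \<chi> (inv x) * one_plus_T_powi (?b x) else 0)"
    unfolding fourier_coeff_def sum_subtractf[symmetric]
    by (rule sum.cong[OF refl])
      (simp add: cayley_laplacian_def algebra_simps linear_character_one[OF assms])
  also have "\<dots> = of_nat (card S) - (\<Sum>x\<in>S. \<chi> (inv x) * one_plus_T_powi (?b x))"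
    using S_subset by (simp add: sum.If_cases Int_absorb1)
  also have "(\<Sum>x\<in>S. \<chi> (inv x) * one_plus_T_powi (?b x)) =
      (\<Sum>s\<in>S. \<chi> (inv (inv s)) * one_plus_T_powi (?b (inv s)))"
    by (rule sum.reindex_bij_betw[OF bij_betw_inv_S, symmetric])
  also have "\<dots> = (\<Sum>s\<in>S. \<chi> s * one_plus_T_powi (- ?b s))"
    using S_subset by (intro sum.cong refl) (auto simp: padic_to_int_\<beta>_inv)
  finally show ?thesis .
qed

lemma fps_of_poly_character_poly:
  "fps_of_poly (character_poly \<iota> S \<beta> \<psi>) = one_plus_T_powi (beta_max S \<beta>) *
    (of_nat (card S) - (\<Sum>s\<in>S. fps_const (\<iota> (\<psi> s)) * one_plus_T_powi (- padic_to_int (\<beta> s))))"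
proof -
  let ?m = "beta_max S \<beta>" and ?b = "\<lambda>s. padic_to_int (\<beta> s)"
  have shift: "one_plus_T_powi (?m - b) = one_plus_T_powi ?m * (one_plus_T_powi (- b) :: 'p padic_bar fps)"
    for b
    using one_plus_T_powi_add[of ?m "- b"] by simp
  have "fps_of_poly (character_poly \<iota> S \<beta> \<psi>) = of_nat (card S) * one_plus_T_powi ?m -
      (\<Sum>s\<in>S. fps_const (\<iota> (\<psi> s)) * one_plus_T_powi (?m - ?b s))"
    unfolding character_poly_def fps_of_poly_diff fps_of_poly_mult fps_of_poly_sum fps_of_poly_smult
    using beta_max_nonneg padic_to_int_\<beta>_le_beta_max
    by (simp add: fps_of_poly_one_plus_T_power of_nat_poly fps_of_poly_const fps_of_nat)
  also have "\<dots> = one_plus_T_powi ?m *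
      (of_nat (card S) - (\<Sum>s\<in>S. fps_const (\<iota> (\<psi> s)) * one_plus_T_powi (- ?b s)))"
    by (simp only: shift right_diff_distrib sum_distrib_left mult_ac)
  finally show ?thesis .
qed

lemma fourier_coeff_cayley_laplacian_eq_character_poly:
  assumes "algebraic_embedding \<iota>" "\<psi> \<in> characters G"
  shows "fourier_coeff G (cayley_laplacian G S \<beta>) (\<lambda>x. fps_const (\<iota> (\<psi> x))) =
    fps_of_poly (character_poly \<iota> S \<beta> \<psi>) * one_plus_T_powi (- beta_max S \<beta>)"
proof -
  let ?m = "beta_max S \<beta>" and ?\<chi> = "\<lambda>x. fps_const (\<iota> (\<psi> x))"
  let ?c = "fourier_coeff G (cayley_laplacian G S \<beta>) ?\<chi>"
  have "linear_character G ?\<chi>" using assms by (rule linear_character_fps_const_embedding)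
  then have poly: "fps_of_poly (character_poly \<iota> S \<beta> \<psi>) = one_plus_T_powi ?m * ?c"
    by (simp only: fourier_coeff_cayley_laplacian fps_of_poly_character_poly)
  have "?c = ?c * one_plus_T_powi (?m + - ?m)" by simp
  also have "\<dots> = (one_plus_T_powi ?m * ?c) * one_plus_T_powi (- ?m)"
    by (simp only: one_plus_T_powi_add mult_ac)
  finally show ?thesis unfolding poly .
qed

end

theorem theorem4p5:
  fixes G :: "('g, 'm) monoid_scheme"
    and S :: "'g set"
    and \<beta> :: "'g \<Rightarrow> 'p::prime_card padic_int"
    and \<iota> :: "complex \<Rightarrow> 'p padic_bar"
    and g :: "nat \<Rightarrow> 'g"
  assumes "comm_group G" and "finite (carrier G)"
    and "S \<subseteq> carrier G" and "generate G S = carrier G"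
    and "m_inv G ` S = S" and "\<one>\<^bsub>G\<^esub> \<notin> S"
    and "card S \<notin> {1, 2}"
    and "module.span (*) (\<beta> ` S) = UNIV"
    and "\<forall>s\<in>S. \<beta> (inv\<^bsub>G\<^esub> s) = - \<beta> s"
    and "\<beta> ` S \<subseteq> \<int>"
    and "\<exists>(m::nat) (h::nat \<Rightarrow> 'g). m > 0 \<and> (\<forall>i\<in>{1..m}. h i \<in> S) \<and> finprod G h {1..m} \<in> S \<and>
           \<not> of_nat CARD('p) dvd \<beta> (finprod G h {1..m}) - (\<Sum>i=1..m. \<beta> (h i))"
    and "bij_betw g {..<card (carrier G)} (carrier G)"
    and "algebraic_embedding \<iota>"
  shows "\<exists>u \<in> fps_units_over (padic_valuation_ring (cyclotomic_padic_field (card (carrier G)))).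
           fps_to_bar (iwasawa_poly (cayley_graph G S) (cayley_voltage G \<beta>) g) =
             (\<Prod>\<psi>\<in>characters G. fps_of_poly (character_poly \<iota> S \<beta> \<psi>)) * u"
proof -
  interpret comm_group G by fact
  have "S \<noteq> {}" using assms(11) by auto
  then interpret symmetric_integral_weight G S \<beta>
    using assms(2,3,5,9,10) by unfold_locales simp_all
  let ?m = "beta_max S \<beta>" and ?n = "card (carrier G)"
  have "fps_to_bar (iwasawa_poly (cayley_graph G S) (cayley_voltage G \<beta>) g) =
      (\<Prod>\<psi>\<in>characters G. fourier_coeff G (cayley_laplacian G S \<beta>) (\<lambda>x. fps_const (\<iota> (\<psi> x))))"
    using assms(12,13) by (simp add: fps_to_bar_iwasawa_poly det_group_matrix_characters)
  also have "\<dots> = (\<Prod>\<psi>\<in>characters G. fps_of_poly (character_poly \<iota> S \<beta> \<psi>) * one_plus_T_powi (- ?m))"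
    using assms(13) by (simp add: fourier_coeff_cayley_laplacian_eq_character_poly)
  also have "\<dots> = (\<Prod>\<psi>\<in>characters G. fps_of_poly (character_poly \<iota> S \<beta> \<psi>)) *
      one_plus_T_powi (int ?n * - ?m)"
    by (simp only: prod.distrib prod_constant card_characters one_plus_T_powi_power)
  finally show ?thesis
    using one_plus_T_powi_in_fps_units_over[OF range_of_int_subset_valuation_ring[OF
      range_to_ac_subset_cyclotomic_padic_field]] by blast
qed

end
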